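(* Let $e \ge 1$ and $2 \le m \le n$. The Cartesian product $P_m \square P_n$ admits an $e$-quasi-perfect code if one of the following holds: (i) $m = n = 2e+3$; (ii) $m = e+1$ and $n = e+3$.
   Context: All graphs are simple and connected; $d(x,y)$ is the shortest-path distance. $P_n$ is the path on $n$ vertices. The Cartesian product $G\square H$ has vertex set $V(G)\times V(H)$, with $(g_1,h_1)$ adjacent to $(g_2,h_2)$ iff either $h_1=h_2$ and $g_1g_2\in E(G)$, or $g_1=g_2$ and $h_1h_2\in E(H)$. A code is a subset $D$ of the vertex set. $D$ is $t$-error-correcting if any two distinct codewords are at distance at least $2t+1$. The covering radius of $D$ is the smallest $r$ such that every vertex is at distance at most $r$ from some codeword. $D$ is $t$-quasi-perfect if it is $t$-error-correcting with covering radius $t+1$. *)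

theory Defs
  imports
    "Graph_Theory.Pair_Digraph"
    "Graph_Theory.Shortest_Path"
    "HOL-Library.Extended_Nat"
begin

text \<open>Simple graphs are represented as loop-free symmetric digraphs
  (\<^locale>\<open>pair_graph\<close>): each edge gives a pair of opposite arcs.\<close>

definition path_graph :: "nat \<Rightarrow> nat pair_pre_digraph" where
  "path_graph n = \<lparr>pverts = {..<n},
     parcs = {(i, j). i < n \<and> j < n \<and> (j = Suc i \<or> i = Suc j)}\<rparr>"

definition cartesian_product ::
    "'a pair_pre_digraph \<Rightarrow> 'b pair_pre_digraph \<Rightarrow> ('a \<times> 'b) pair_pre_digraph"
    (infixr \<open>\<box>\<close> 80) where
  "G \<box> H = \<lparr>pverts = pverts G \<times> pverts H,
     parcs = {((g1, h1), (g2, h2)).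
       h1 \<in> pverts H \<and> h1 = h2 \<and> (g1, g2) \<in> parcs G \<or>
       g1 \<in> pverts G \<and> g1 = g2 \<and> (h1, h2) \<in> parcs H}\<rparr>"

definition graph_dist :: "'a pair_pre_digraph \<Rightarrow> 'a \<Rightarrow> 'a \<Rightarrow> ereal" where
  "graph_dist G u v = wf_digraph.\<mu> (with_proj G) (\<lambda>_. 1) u v"

definition error_correcting :: "'a pair_pre_digraph \<Rightarrow> nat \<Rightarrow> 'a set \<Rightarrow> bool" where
  "error_correcting G t D \<longleftrightarrow>
     (\<forall>x\<in>D. \<forall>y\<in>D. x \<noteq> y \<longrightarrow> ereal (real (2 * t + 1)) \<le> graph_dist G x y)"

definition covers_within :: "'a pair_pre_digraph \<Rightarrow> 'a set \<Rightarrow> nat \<Rightarrow> bool" where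
  "covers_within G D r \<longleftrightarrow>
     (\<forall>v\<in>pverts G. \<exists>c\<in>D. graph_dist G v c \<le> ereal (real r))"

text \<open>The infimum is taken in \<^typ>\<open>enat\<close>, so that it is a minimum whenever some
  radius works, and \<open>\<infinity>\<close> otherwise (e.g. for the empty code).\<close>

definition covering_radius :: "'a pair_pre_digraph \<Rightarrow> 'a set \<Rightarrow> enat" where
  "covering_radius G D = (INF r \<in> {r. covers_within G D r}. enat r)"

definition quasi_perfect_code :: "'a pair_pre_digraph \<Rightarrow> nat \<Rightarrow> 'a set \<Rightarrow> bool" where
  "quasi_perfect_code G t D \<longleftrightarrow>
     D \<subseteq> pverts G \<and> error_correcting G t D \<and> covering_radius G D = enat (t + 1)"


lemma pair_graph_path_graph: "pair_graph (path_graph n)"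
proof
  show "finite (parcs (path_graph n))"
    by (rule finite_subset[of _ "{..<n} \<times> {..<n}"]) (auto simp: path_graph_def)
qed (auto simp: path_graph_def symmetric_def sym_def)

lemma pair_graph_cartesian_product:
  assumes "pair_graph G" "pair_graph H"
  shows "pair_graph (G \<box> H)"
proof -
  interpret G: pair_graph G by fact
  interpret H: pair_graph H by fact
  have sub: "parcs (G \<box> H) \<subseteq> (pverts G \<times> pverts H) \<times> (pverts G \<times> pverts H)"
    by (auto simp: cartesian_product_def dest: G.wellformed' H.wellformed')
  have symG: "(b, a) \<in> parcs G" if "(a, b) \<in> parcs G" for a b
    using that G.pair_sym_arcs by (auto simp: symmetric_def sym_def)
  have symH: "(b, a) \<in> parcs H" if "(a, b) \<in> parcs H" for a b
    using that H.pair_sym_arcs by (auto simp: symmetric_def sym_def)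
  show ?thesis
  proof
    show "finite (pverts (G \<box> H))"
      by (simp add: cartesian_product_def G.pair_finite_verts H.pair_finite_verts)
    show "finite (parcs (G \<box> H))"
      by (rule finite_subset[OF sub]) (simp add: G.pair_finite_verts H.pair_finite_verts)
    show "symmetric (with_proj (G \<box> H))"
      by (auto simp: symmetric_def sym_def cartesian_product_def intro: symG symH)
    show "fst e \<in> pverts (G \<box> H)" "snd e \<in> pverts (G \<box> H)"
      if "e \<in> parcs (G \<box> H)" for e
      using that sub by (auto simp: cartesian_product_def dest: G.wellformed' H.wellformed')
    show "fst e \<noteq> snd e" if "e \<in> parcs (G \<box> H)" for e
      using that G.pair_no_loops H.pair_no_loops by (fastforce simp: cartesian_product_def)
  qed
qed

lemma graph_dist_eq:
  fixes G :: "'a pair_pre_digraph"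
  assumes "pair_graph G"
  shows "graph_dist G u v =
    (INF p \<in> {p. pre_digraph.awalk (with_proj G) u p v}. ereal (real (length p)))"
proof -
  interpret pair_graph G by fact
  have wf: "wf_digraph (with_proj G)" by unfold_locales
  have "wf_digraph.awalk_cost (\<lambda>_. 1) p = real (length p)" for p :: "('a \<times> 'a) awalk"
    by (simp add: wf_digraph.awalk_cost_def[OF wf] sum_list_triv)
  then show ?thesis
    by (simp add: graph_dist_def wf_digraph.\<mu>_def[OF wf])
qed

lemma covering_radius_eq_enat_iff:
  "covering_radius G D = enat r \<longleftrightarrow>
     covers_within G D r \<and> (\<forall>s. covers_within G D s \<longrightarrow> r \<le> s)"
proof
  assume eq: "covering_radius G D = enat r"
  let ?A = "enat ` {r. covers_within G D r}"
  have "?A \<noteq> {}"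
  proof
    assume "?A = {}"
    then have "covering_radius G D = \<infinity>"
      unfolding covering_radius_def by (simp only: Inf_empty top_enat_def)
    then show False using eq by simp
  qed
  then have "Inf ?A \<in> ?A" by (metis Inf_enat_def LeastI ex_in_conv)
  then have "covers_within G D r" using eq by (auto simp: covering_radius_def)
  moreover have "r \<le> s" if "covers_within G D s" for s
  proof -
    have "Inf ?A \<le> enat s" using that by (intro Inf_lower) auto
    then show ?thesis using eq by (simp add: covering_radius_def)
  qed
  ultimately show "covers_within G D r \<and> (\<forall>s. covers_within G D s \<longrightarrow> r \<le> s)" by blast
next
  assume "covers_within G D r \<and> (\<forall>s. covers_within G D s \<longrightarrow> r \<le> s)"
  then show "covering_radius G D = enat r"
    unfolding covering_radius_def by (intro antisym INF_lower INF_greatest) auto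
qed

end

theory Submission
  imports Defs
begin

text \<open>Distance in the grid \<open>P\<^sub>m \<box> P\<^sub>n\<close> is Manhattan distance. For \<open>m = n = 2e + 3\<close> take the
  centre and the four corners: if the two offsets of a vertex from the centre add up to \<open>s\<close>, the
  vertex is at distance \<open>s\<close> from the centre and \<open>2e + 2 - s\<close> from the nearest corner. For
  \<open>m = e + 1\<close>, \<open>n = e + 3\<close> take two opposite corners: the distances of a vertex to them add up
  to \<open>2e + 2\<close>. In both cases the smaller distance is at most \<open>e + 1\<close>, with equality for some
  vertex.\<close>

fun manhattan :: "nat \<times> nat \<Rightarrow> nat \<times> nat \<Rightarrow> nat" where
  "manhattan (a, b) (c, d) = nat (\<bar>int a - int c\<bar> + \<bar>int b - int d\<bar>)"

abbreviation grid :: "nat \<Rightarrow> nat \<Rightarrow> (nat \<times> nat) pair_pre_digraph" where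
  "grid m n \<equiv> path_graph m \<box> path_graph n"

lemma pair_graph_grid: "pair_graph (grid m n)"
  by (intro pair_graph_cartesian_product pair_graph_path_graph)

lemma pverts_grid [simp]: "pverts (grid m n) = {..<m} \<times> {..<n}"
  by (simp add: cartesian_product_def path_graph_def)

text \<open>Two offsets sum to 1 exactly when one is 0 and the other is 1, so later arguments need
  not distinguish horizontal from vertical arcs.\<close>

lemma parcs_grid_iff:
  "(u, v) \<in> parcs (grid m n) \<longleftrightarrow>
     u \<in> pverts (grid m n) \<and> v \<in> pverts (grid m n) \<and> manhattan u v = 1"
  by (cases u; cases v) (auto simp: cartesian_product_def path_graph_def)

lemma manhattan_triangle: "manhattan u w \<le> manhattan u v + manhattan v w"
  by (cases u; cases v; cases w) simp

text \<open>Each arc spans Manhattan distance 1, so the triangle inequality adds at most 1 per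
  arc.\<close>

lemma manhattan_le_length_awalk:
  assumes "pre_digraph.awalk (with_proj (grid m n)) u p v"
  shows "manhattan u v \<le> length p"
  using assms
proof (induction p arbitrary: u)
  interpret pair_graph "grid m n" by (rule pair_graph_grid)
  {
    case Nil
    then show ?case by (cases u) (auto simp: awalk_Nil_iff)
  next
    case (Cons a p)
    obtain w where a: "a = (u, w)" "(u, w) \<in> parcs (grid m n)" and p: "awalk w p v"
      using Cons.prems by (cases a) (auto simp: awalk_Cons_iff)
    have "manhattan u w = 1" using a by (simp add: parcs_grid_iff)
    then show ?case
      using Cons.IH[OF p] manhattan_triangle[of u v w] by simp
  }
qed

lemma manhattan_step:
  assumes "u \<in> pverts (grid m n)" "v \<in> pverts (grid m n)" "manhattan u v = Suc k"
  obtains w where "(u, w) \<in> parcs (grid m n)" "manhattan w v = k"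
proof -
  obtain a b c d where uv: "u = (a, b)" "v = (c, d)" by (cases u; cases v) auto
  \<comment> \<open>Move one unit towards \<open>v\<close>, first coordinate first; this cannot
    leave the grid. In the last case \<open>a = c\<close> and, the distance being positive,
    \<open>d < b\<close>, so \<open>b - 1\<close> is not truncated.\<close>
  define w where "w = (if a < c then (a + 1, b) else if c < a then (a - 1, b)
    else if b < d then (a, b + 1) else (a, b - 1))"
  have "(u, w) \<in> parcs (grid m n)" "manhattan w v = k"
    unfolding parcs_grid_iff using assms uv by (auto simp: w_def)
  then show thesis by (rule that)
qed

lemma awalk_of_length_manhattan:
  assumes "u \<in> pverts (grid m n)" "v \<in> pverts (grid m n)"
  shows "\<exists>p. pre_digraph.awalk (with_proj (grid m n)) u p v \<and> length p = manhattan u v"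
  using assms
proof (induction "manhattan u v" arbitrary: u)
  interpret pair_graph "grid m n" by (rule pair_graph_grid)
  {
    case 0
    then have "u = v" by (cases u; cases v) auto
    with 0 have "awalk u [] v" by (simp add: awalk_Nil_iff)
    with 0 show ?case by (metis list.size(3))
  next
    case (Suc k)
    obtain w where w: "(u, w) \<in> parcs (grid m n)" "manhattan w v = k"
      using manhattan_step[OF Suc.prems Suc.hyps(2)[symmetric]] by metis
    then have "w \<in> pverts (grid m n)" by (simp add: parcs_grid_iff)
    then obtain p where "awalk w p v" "length p = k"
      using Suc.hyps(1)[of w] Suc.prems w by auto
    then have "awalk u ((u, w) # p) v \<and> length ((u, w) # p) = manhattan u v"
      using w Suc.prems(1) Suc.hyps(2) by (simp add: awalk_Cons_iff)
    then show ?case by blast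
  }
qed

lemma graph_dist_grid:
  assumes "u \<in> pverts (grid m n)" "v \<in> pverts (grid m n)"
  shows "graph_dist (grid m n) u v = ereal (real (manhattan u v))"
proof (rule antisym)
  obtain p where "pre_digraph.awalk (with_proj (grid m n)) u p v" "length p = manhattan u v"
    using awalk_of_length_manhattan[OF assms] by blast
  then show "graph_dist (grid m n) u v \<le> ereal (real (manhattan u v))"
    unfolding graph_dist_eq[OF pair_graph_grid] by (intro INF_lower2[of p]) auto
  show "ereal (real (manhattan u v)) \<le> graph_dist (grid m n) u v"
    unfolding graph_dist_eq[OF pair_graph_grid]
    by (intro INF_greatest) (simp add: manhattan_le_length_awalk)
qed

text \<open>Translates the task into arithmetic: \<open>cov\<close> bounds the covering radius from
  above by \<open>t + 1\<close>, and the single vertex \<open>v\<close> bounds it from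
  below.\<close>

lemma quasi_perfect_code_gridI:
  assumes sub: "D \<subseteq> {..<m} \<times> {..<n}"
    and sep: "\<And>x y. x \<in> D \<Longrightarrow> y \<in> D \<Longrightarrow> x \<noteq> y \<Longrightarrow> 2 * t + 1 \<le> manhattan x y"
    and cov: "\<And>i j. i < m \<Longrightarrow> j < n \<Longrightarrow> \<exists>c\<in>D. manhattan (i, j) c \<le> t + 1"
    and far: "v \<in> {..<m} \<times> {..<n}" "\<And>c. c \<in> D \<Longrightarrow> t + 1 \<le> manhattan v c"
  shows "quasi_perfect_code (grid m n) t D"
proof -
  have D: "c \<in> pverts (grid m n)" if "c \<in> D" for c
    using sub that by auto
  have covers: "covers_within (grid m n) D r \<longleftrightarrow>
      (\<forall>u \<in> {..<m} \<times> {..<n}. \<exists>c\<in>D. manhattan u c \<le> r)" for r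
    unfolding covers_within_def using D
    by (auto simp: graph_dist_grid simp del: manhattan.simps)
  have "error_correcting (grid m n) t D"
    unfolding error_correcting_def
  proof (intro ballI impI)
    fix x y assume xy: "x \<in> D" "y \<in> D" "x \<noteq> y"
    show "ereal (real (2 * t + 1)) \<le> graph_dist (grid m n) x y"
      unfolding graph_dist_grid[OF D[OF xy(1)] D[OF xy(2)]] ereal_less_eq of_nat_le_iff
      by (rule sep[OF xy])
  qed
  moreover have "covers_within (grid m n) D (t + 1)"
    unfolding covers using cov by blast
  moreover have "t + 1 \<le> s" if "covers_within (grid m n) D s" for s
    using that far unfolding covers by (meson le_trans)
  ultimately show ?thesis
    using sub by (simp add: quasi_perfect_code_def covering_radius_eq_enat_iff)
qed

lemma quasi_perfect_code_square:
  "quasi_perfect_code (grid (2 * e + 3) (2 * e + 3)) e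
     {(e + 1, e + 1), (0, 0), (0, 2 * e + 2), (2 * e + 2, 0), (2 * e + 2, 2 * e + 2)}"
\<comment> \<open>The midpoint of a side is at distance \<open>e + 1\<close> from the centre and
  from both ends of that side; the other two corners are farther.\<close>
proof (rule quasi_perfect_code_gridI[where v = "(e + 1, 0)"])
  fix i j assume ij: "i < 2 * e + 3" "j < 2 * e + 3"
  \<comment> \<open>Away from the centre, take the corner of the quadrant containing
    \<open>(i, j)\<close>: the offsets then sum to at least \<open>e + 2\<close>, leaving distance
    at most \<open>e\<close>.\<close>
  define c where "c = (if manhattan (i, j) (e + 1, e + 1) \<le> e + 1 then (e + 1, e + 1)
    else (if i \<le> e + 1 then 0 else 2 * e + 2, if j \<le> e + 1 then 0 else 2 * e + 2))"
  have "manhattan (i, j) c \<le> e + 1"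
    using ij by (auto simp: c_def)
  moreover have "c \<in> {(e + 1, e + 1), (0, 0), (0, 2 * e + 2), (2 * e + 2, 0), (2 * e + 2, 2 * e + 2)}"
    by (simp add: c_def)
  ultimately show "\<exists>c\<in>{(e + 1, e + 1), (0, 0), (0, 2 * e + 2), (2 * e + 2, 0), (2 * e + 2, 2 * e + 2)}.
      manhattan (i, j) c \<le> e + 1" ..
\<comment> \<open>Distinct codewords are at least \<open>2 * e + 2\<close> apart, with equality
  between the centre and a corner and along a side.\<close>
qed auto

lemma quasi_perfect_code_opposite_corners:
  "quasi_perfect_code (grid (e + 1) (e + 3)) e {(0, 0), (e, e + 2)}"
\<comment> \<open>This vertex is at distance exactly \<open>e + 1\<close> from both
  codewords.\<close>
proof (rule quasi_perfect_code_gridI[where v = "(0, e + 1)"])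
  fix i j assume "i < e + 1" "j < e + 3"
  then show "\<exists>c\<in>{(0, 0), (e, e + 2)}. manhattan (i, j) c \<le> e + 1"
    \<comment> \<open>The two distances are \<open>i + j\<close> and
      \<open>2 * e + 2 - (i + j)\<close>, so the disjunction is linear arithmetic.\<close>
    unfolding bex_simps manhattan.simps by arith
qed auto

theorem theorem12:
  fixes e m n :: nat
  assumes "e \<ge> 1" and "2 \<le> m" and "m \<le> n"
    and "(m = 2 * e + 3 \<and> n = 2 * e + 3) \<or> (m = e + 1 \<and> n = e + 3)"
  shows "\<exists>D. quasi_perfect_code (path_graph m \<box> path_graph n) e D"
  using assms(4) quasi_perfect_code_square quasi_perfect_code_opposite_corners by blast

end
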